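(* Let $n\ge 2$, let $Q\in\mathbb{R}^{n\times n}$ be symmetric and let $\mathbf{c}\in\mathbb{R}^n$. The problem $(\mathcal{P}^d)$ is canonically dual to $(\mathcal{P})$ in the following sense. For $\bar\sigma\in\mathcal{S}_a$, put $\bar{\mathbf{x}}=G(\bar\sigma)^{-1}\mathbf{c}$. Then $\bar\sigma$ is a KKT point of $(\mathcal{P}^d)$ if and only if $\bar{\mathbf{x}}$ is a KKT point of $(\mathcal{P})$, and in this case $$P(\bar{\mathbf{x}})=P^d(\bar\sigma).$$
   Context: Lorentz cone: $\mathcal{C}=\{(x_1,\mathbf{x}_2)\in\mathbb{R}\times\mathbb{R}^{n-1} : \|\mathbf{x}_2\|\le x_1,\ x_1>0\}$. Primal problem: $(\mathcal{P})$: $\min\{P(\mathbf{x})=\tfrac12\langle \mathbf{x},Q\mathbf{x}\rangle-\langle \mathbf{x},\mathbf{c}\rangle : \mathbf{x}\in\mathcal{C}\}$. Lorentz matrix: $L_o=\begin{pmatrix}-1&0\\0&I_{n-1}\end{pmatrix}$, where $I_{n-1}$ is the identity matrix of size $n-1$. For $\sigma\in\mathbb{R}$, $G(\sigma)=Q+\sigma L_o$. Dual feasible set: $\mathcal{S}_a=\{\sigma\in\mathbb{R} : \sigma\ge 0,\ \det G(\sigma)\ne 0\}$. Dual problem: $(\mathcal{P}^d)$: $\max\{P^d(\sigma)=-\tfrac12\langle \mathbf{c},G(\sigma)^{-1}\mathbf{c}\rangle : \sigma\in\mathcal{S}_a\}$. KKT points. In $(\mathcal{P})$ the cone constraint is treated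 in the quadratic form $\tfrac12\mathbf{x}^TL_o\mathbf{x}\le 0$. A vector $\mathbf{x}\in\mathbb{R}^n$ is a KKT point of $(\mathcal{P})$ if there is $\sigma\in\mathbb{R}$ with $G(\sigma)\mathbf{x}=\mathbf{c}$, $\sigma\ge 0$, $\mathbf{x}^TL_o\mathbf{x}\le 0$ and $\sigma\,\mathbf{x}^TL_o\mathbf{x}=0$. A number $\sigma\in\mathcal{S}_a$ is a KKT point of $(\mathcal{P}^d)$ if $\sigma\ge0$, $\frac{dP^d}{d\sigma}(\sigma)\le 0$ and $\sigma\,\frac{dP^d}{d\sigma}(\sigma)=0$. *)

theory Defs
  imports "HOL-Analysis.Analysis"
begin

text \<open>
  Vectors of $R^n$ have type \<open>real ^ 'n\<close>, with $n$ the cardinality of \<open>'n\<close>. The type carries no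
  first index, so the position \<open>p :: 'n\<close> of the scalar part $x_1$ of $x = (x_1, x_2)$ is an
  explicit parameter; the other indices carry the part $x_2$ in $R^{n-1}$.
\<close>

definition lorentz_cone :: "'n::finite \<Rightarrow> (real ^ 'n) set" where
  "lorentz_cone p = {x. L2_set (\<lambda>i. x $ i) (- {p}) \<le> x $ p \<and> x $ p > 0}"

definition lorentz_matrix :: "'n::finite \<Rightarrow> real ^ 'n ^ 'n" where
  "lorentz_matrix p = (\<chi> i j. if i = j then (if i = p then - 1 else 1) else 0)"

definition primal_obj :: "real ^ 'n ^ 'n \<Rightarrow> real ^ 'n \<Rightarrow> real ^ 'n::finite \<Rightarrow> real" where
  "primal_obj Q c x = 1/2 * (x \<bullet> (Q *v x)) - x \<bullet> c"

definition G :: "'n::finite \<Rightarrow> real ^ 'n ^ 'n \<Rightarrow> real \<Rightarrow> real ^ 'n ^ 'n" where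
  "G p Q \<sigma> = Q + \<sigma> *\<^sub>R lorentz_matrix p"

definition dual_feasible :: "'n::finite \<Rightarrow> real ^ 'n ^ 'n \<Rightarrow> real set" where
  "dual_feasible p Q = {\<sigma>. \<sigma> \<ge> 0 \<and> det (G p Q \<sigma>) \<noteq> 0}"

definition dual_obj :: "'n::finite \<Rightarrow> real ^ 'n ^ 'n \<Rightarrow> real ^ 'n \<Rightarrow> real \<Rightarrow> real" where
  "dual_obj p Q c \<sigma> = - 1/2 * (c \<bullet> (matrix_inv (G p Q \<sigma>) *v c))"

text \<open>
  The Karush-Kuhn-Tucker conditions of the primal problem (minimise \<open>primal_obj Q c\<close> over
  \<open>lorentz_cone p\<close>) are those of the constraint in its quadratic form
  \<open>1/2 * (x \<bullet> (lorentz_matrix p *v x)) \<le> 0\<close>. They do not impose \<open>x $ p > 0\<close>, which is what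
  separates this constraint from membership in the cone, see \<open>lorentz_cone_iff\<close> below.
\<close>

definition primal_KKT :: "'n::finite \<Rightarrow> real ^ 'n ^ 'n \<Rightarrow> real ^ 'n \<Rightarrow> real ^ 'n \<Rightarrow> bool" where
  "primal_KKT p Q c x \<longleftrightarrow>
    (\<exists>\<sigma>. G p Q \<sigma> *v x = c \<and> \<sigma> \<ge> 0 \<and>
         x \<bullet> (lorentz_matrix p *v x) \<le> 0 \<and> \<sigma> * (x \<bullet> (lorentz_matrix p *v x)) = 0)"

text \<open>
  \<open>dual_obj\<close> is given by the same formula on the open set where \<open>det (G p Q \<sigma>) \<noteq> 0\<close>, also for
  negative \<open>\<sigma>\<close>, so the derivative at every dual feasible point, including 0, is the ordinary
  two-sided one.
\<close>

definition dual_KKT :: "'n::finite \<Rightarrow> real ^ 'n ^ 'n \<Rightarrow> real ^ 'n \<Rightarrow> real \<Rightarrow> bool" where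
  "dual_KKT p Q c \<sigma> \<longleftrightarrow>
    \<sigma> \<in> dual_feasible p Q \<and> \<sigma> \<ge> 0 \<and>
    deriv (dual_obj p Q c) \<sigma> \<le> 0 \<and> \<sigma> * deriv (dual_obj p Q c) \<sigma> = 0"

lemma lorentz_quadratic_form:
  "x \<bullet> (lorentz_matrix p *v x) = (\<Sum>i\<in>- {p}. (x $ i)\<^sup>2) - (x $ p)\<^sup>2"
proof -
  have "(lorentz_matrix p *v x) $ i = (if i = p then - x $ i else x $ i)" for i
    by (auto simp: lorentz_matrix_def matrix_vector_mult_def if_distrib[of "\<lambda>a. a * _"] cong: if_cong)
  then have "x \<bullet> (lorentz_matrix p *v x) =
      (\<Sum>i\<in>UNIV. if i = p then - (x $ i)\<^sup>2 else (x $ i)\<^sup>2)"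
    unfolding inner_vec_def by (auto intro!: sum.cong simp: power2_eq_square)
  also have "\<dots> = - (x $ p)\<^sup>2 + (\<Sum>i\<in>UNIV - {p}. if i = p then - (x $ i)\<^sup>2 else (x $ i)\<^sup>2)"
    by (subst sum.remove[of _ p]) auto
  also have "(\<Sum>i\<in>UNIV - {p}. if i = p then - (x $ i)\<^sup>2 else (x $ i)\<^sup>2) = (\<Sum>i\<in>- {p}. (x $ i)\<^sup>2)"
    by (rule sum.cong) auto
  finally show ?thesis by simp
qed

lemma lorentz_cone_iff:
  "x \<in> lorentz_cone p \<longleftrightarrow> 1/2 * (x \<bullet> (lorentz_matrix p *v x)) \<le> 0 \<and> x $ p > 0"
  unfolding lorentz_cone_def lorentz_quadratic_form L2_set_def
  by (auto simp: sqrt_le_D intro: real_le_lsqrt sum_nonneg)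

end

theory Submission
  imports Defs
begin

text \<open>
  With \<open>x s = matrix_inv (G p Q s) *v c\<close>, symmetry of \<open>Q\<close> gives the resolvent identity
  \<open>c \<bullet> x s - c \<bullet> x t = - (s - t) * (x s \<bullet> (lorentz_matrix p *v x t))\<close>. Since \<open>x\<close> is continuous at a
  dual feasible point by Cramer's rule, the dual objective has derivative
  \<open>1/2 * (x t \<bullet> (lorentz_matrix p *v x t))\<close> there, so the dual conditions at \<open>t\<close> are the primal ones
  at \<open>x t\<close> with multiplier \<open>t\<close>. Conversely, as the Lorentz matrix is invertible, a nonzero \<open>x t\<close>
  determines its multiplier, and for \<open>x t = 0\<close> the conditions are trivial.
\<close>

text \<open>By the Leibniz expansion the determinant is a polynomial in the entries.\<close>

lemma continuous_det [continuous_intros]: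
  fixes A :: "'a::t2_space \<Rightarrow> real ^ 'n ^ 'n::finite"
  assumes "\<And>i j. continuous F (\<lambda>s. A s $ i $ j)"
  shows "continuous F (\<lambda>s. det (A s))"
  unfolding det_def by (intro continuous_intros assms)

lemma matrix_inv_mult_vector_iff:
  fixes A :: "real ^ 'n ^ 'n::finite"
  assumes "det A \<noteq> 0"
  shows "x = matrix_inv A *v b \<longleftrightarrow> A *v x = b"
proof -
  \<comment> \<open>\<open>matrix_inv\<close> is a choice term, so a two-sided inverse must exist
    before anything can be said about it.\<close>
  have "\<exists>B. A ** B = mat 1 \<and> B ** A = mat 1"
    using assms invertible_det_nz[of A] unfolding invertible_def by blast
  then have "A ** matrix_inv A = mat 1 \<and> matrix_inv A ** A = mat 1"
    unfolding matrix_inv_def by (rule someI_ex[where P = "\<lambda>B. A ** B = mat 1 \<and> B ** A = mat 1"])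
  then have "A *v (matrix_inv A *v b) = b" "matrix_inv A *v (A *v x) = x"
    by (simp_all add: matrix_vector_mul_assoc)
  then show ?thesis
    by auto
qed

lemma isCont_matrix_inv_mult_vector:
  fixes A :: "'a::t2_space \<Rightarrow> real ^ 'n ^ 'n::finite"
  assumes cont: "\<And>i j. isCont (\<lambda>s. A s $ i $ j) t"
    and det: "det (A t) \<noteq> 0"
  shows "isCont (\<lambda>s. matrix_inv (A s) *v b) t"
proof -
  have det_cont: "isCont (\<lambda>s. det (A s)) t"
    by (intro continuous_intros cont)
  \<comment> \<open>The numerators in Cramer's rule: column \<open>k\<close> of \<open>A s\<close>
    is replaced by \<open>b\<close>.\<close>
  let ?N = "\<lambda>s k. det (\<chi> i j. if j = k then b $ i else A s $ i $ j)"
  have N_cont: "isCont (\<lambda>s. ?N s k) t" for k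
  proof (rule continuous_det)
    show "isCont (\<lambda>s. (\<chi> i j. if j = k then b $ i else A s $ i $ j) $ i $ j) t" for i j
      by (cases "j = k") (auto intro: cont)
  qed
  have "isCont (\<lambda>s. \<chi> k. ?N s k / det (A s)) t"
    unfolding isCont_def
    by (intro tendsto_vec_lambda tendsto_divide det_cont[unfolded isCont_def]
        N_cont[unfolded isCont_def] det)
  moreover
  \<comment> \<open>Cramer's formula is available only where the determinant is nonzero. The filter
    is \<open>nhds t\<close> because the two functions must agree at \<open>t\<close> itself as
    well.\<close>
  have "\<forall>\<^sub>F s in nhds t. det (A s) \<noteq> 0"
    using det_cont det unfolding continuous_within
    by (auto simp: eventually_nhds_conv_at intro: tendsto_imp_eventually_ne)
  then have "\<forall>\<^sub>F s in nhds t. matrix_inv (A s) *v b = (\<chi> k. ?N s k / det (A s))"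
  proof (rule eventually_mono)
    fix s assume s: "det (A s) \<noteq> 0"
    then have "A s *v (matrix_inv (A s) *v b) = b"
      by (simp flip: matrix_inv_mult_vector_iff)
    then show "matrix_inv (A s) *v b = (\<chi> k. ?N s k / det (A s))"
      by (simp only: cramer[OF s])
  qed
  from isCont_cong[OF this]
  have "isCont (\<lambda>s. matrix_inv (A s) *v b) t \<longleftrightarrow> isCont (\<lambda>s. \<chi> k. ?N s k / det (A s)) t" .
  ultimately show ?thesis
    by blast
qed

lemma G_mult_vector: "G p Q s *v x = Q *v x + s *\<^sub>R (lorentz_matrix p *v x)"
  by (simp add: G_def matrix_vector_mult_add_rdistrib scaleR_matrix_vector_assoc)

lemma transpose_lorentz_matrix: "transpose (lorentz_matrix p) = lorentz_matrix p"
  by (auto simp: lorentz_matrix_def transpose_def vec_eq_iff)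

text \<open>The Lorentz matrix only flips the sign of coordinate \<open>p\<close>. This injectivity
  later pins down the multiplier.\<close>

lemma lorentz_matrix_mult_vector_eq_0_iff: "lorentz_matrix p *v x = 0 \<longleftrightarrow> x = 0"
proof -
  have "(lorentz_matrix p *v x) $ i = (if i = p then - x $ i else x $ i)" for i
    by (auto simp: lorentz_matrix_def matrix_vector_mult_def if_distrib[of "\<lambda>a. a * _"] cong: if_cong)
  then show ?thesis
    by (auto simp: vec_eq_iff)
qed

lemma transpose_G:
  assumes "transpose Q = Q"
  shows "transpose (G p Q s) = G p Q s"
  using assms transpose_lorentz_matrix[of p] by (auto simp: G_def transpose_def vec_eq_iff)

lemma dual_obj_has_field_derivative:
  fixes Q :: "real ^ 'n ^ 'n" and c x :: "real ^ 'n" and p :: "'n::finite"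
  assumes sym: "transpose Q = Q"
    and det: "det (G p Q t) \<noteq> 0"
    and x: "x = matrix_inv (G p Q t) *v c"
  shows "(dual_obj p Q c has_field_derivative 1/2 * (x \<bullet> (lorentz_matrix p *v x))) (at t)"
proof -
  let ?L = "lorentz_matrix p"
  let ?x = "\<lambda>s. matrix_inv (G p Q s) *v c"
  have G_cont: "isCont (\<lambda>s. G p Q s $ i $ j) t" for i j
    unfolding G_def by (simp add: continuous_intros)
  have x_cont: "isCont ?x t"
    by (rule isCont_matrix_inv_mult_vector[OF G_cont det])
  have "isCont (\<lambda>s. det (G p Q s)) t"
    by (intro continuous_intros G_cont)
  then have ev: "\<forall>\<^sub>F s in at t. det (G p Q s) \<noteq> 0"
    using det unfolding continuous_within by (rule tendsto_imp_eventually_ne)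
  \<comment> \<open>An exact formula for the increment: after division by \<open>s - t\<close>,
    continuity of \<open>?x\<close> at \<open>t\<close> is enough, and the matrix inverse need not
    be differentiated.\<close>
  have resolvent: "dual_obj p Q c s - dual_obj p Q c t = (s - t) * (1/2 * (?x s \<bullet> (?L *v x)))"
    if "det (G p Q s) \<noteq> 0" for s
  proof -
    have s: "G p Q s *v ?x s = c" and t: "G p Q t *v x = c"
      using matrix_inv_mult_vector_iff[OF that] matrix_inv_mult_vector_iff[OF det] x by blast+
    have "c \<bullet> ?x s = (G p Q t *v x) \<bullet> ?x s"
      using t by simp
    also have "\<dots> = (G p Q s *v x) \<bullet> ?x s - (s - t) * (?x s \<bullet> (?L *v x))"
      by (simp add: G_mult_vector inner_add_left inner_commute algebra_simps)
    \<comment> \<open>Symmetry of \<open>Q\<close> lets \<open>G p Q s\<close> pass to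
      \<open>?x s\<close>, where it yields \<open>c\<close>.\<close>
    also have "(G p Q s *v x) \<bullet> ?x s = x \<bullet> (G p Q s *v ?x s)"
      using dot_lmul_matrix[of x "G p Q s" "?x s"] transpose_matrix_vector[of "G p Q s" x]
      by (simp add: transpose_G[OF sym])
    also have "\<dots> = c \<bullet> x"
      using s by (simp add: inner_commute)
    finally show ?thesis
      by (simp add: dual_obj_def x[symmetric] field_simps)
  qed
  have "((\<lambda>s. 1/2 * (?x s \<bullet> (?L *v x))) \<longlongrightarrow> 1/2 * (x \<bullet> (?L *v x))) (at t)"
    using x_cont unfolding isCont_def x[symmetric] by (intro tendsto_intros)
  moreover have "\<forall>\<^sub>F s in at t.
      1/2 * (?x s \<bullet> (?L *v x)) = (dual_obj p Q c s - dual_obj p Q c t) / (s - t)"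
    using ev eventually_neq_at_within[of t t UNIV]
    by eventually_elim (subst resolvent, assumption, subst nonzero_mult_div_cancel_left, simp_all)
  ultimately show ?thesis
    unfolding has_field_derivative_iff by (rule Lim_transform_eventually)
qed

theorem theorem1:
  fixes Q :: "real ^ 'n ^ 'n" and c xbar :: "real ^ 'n" and p :: "'n::finite"
    and \<sigma>bar :: real
  assumes "CARD('n) \<ge> 2"
    and "transpose Q = Q"
    and "\<sigma>bar \<in> dual_feasible p Q"
    and "xbar = matrix_inv (G p Q \<sigma>bar) *v c"
  shows "(dual_KKT p Q c \<sigma>bar \<longleftrightarrow> primal_KKT p Q c xbar) \<and>
    (dual_KKT p Q c \<sigma>bar \<longrightarrow> primal_obj Q c xbar = dual_obj p Q c \<sigma>bar)"
proof -
  define q where "q = xbar \<bullet> (lorentz_matrix p *v xbar)"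
  have nonneg: "\<sigma>bar \<ge> 0" and det: "det (G p Q \<sigma>bar) \<noteq> 0"
    using assms(3) by (auto simp: dual_feasible_def)
  have c: "G p Q \<sigma>bar *v xbar = c"
    using matrix_inv_mult_vector_iff[OF det] assms(4) by blast
  have "deriv (dual_obj p Q c) \<sigma>bar = 1/2 * q"
    unfolding q_def by (intro DERIV_imp_deriv dual_obj_has_field_derivative assms det)
  then have dual: "dual_KKT p Q c \<sigma>bar \<longleftrightarrow> q \<le> 0 \<and> \<sigma>bar * q = 0"
    using assms(3) nonneg by (auto simp: dual_KKT_def)
  \<comment> \<open>The multiplier \<open>s\<close> supplied by the primal conditions may differ
    from \<open>\<sigma>bar\<close>. Subtracting the two stationarity equations leaves
    \<open>s - \<sigma>bar\<close> times the Lorentz image of \<open>xbar\<close>, so they differ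
    only if \<open>xbar = 0\<close>, and then \<open>q = 0\<close>.\<close>
  have "q \<le> 0 \<and> \<sigma>bar * q = 0" if primal: "primal_KKT p Q c xbar"
  proof -
    obtain s where s: "G p Q s *v xbar = c" "q \<le> 0" "s * q = 0"
      using primal unfolding primal_KKT_def q_def by blast
    have "Q *v xbar + s *\<^sub>R (lorentz_matrix p *v xbar) =
        Q *v xbar + \<sigma>bar *\<^sub>R (lorentz_matrix p *v xbar)"
      using s(1) c unfolding G_mult_vector by (rule trans[OF _ sym])
    then have "(s - \<sigma>bar) *\<^sub>R (lorentz_matrix p *v xbar) = 0"
      by (simp add: scaleR_diff_left)
    then have "s = \<sigma>bar \<or> xbar = 0"
      by (simp add: lorentz_matrix_mult_vector_eq_0_iff)
    then show ?thesis
      using s(2,3) by (auto simp: q_def)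
  qed
  \<comment> \<open>For the other direction, \<open>\<sigma>bar\<close> itself serves as the primal
    multiplier.\<close>
  then have iff: "dual_KKT p Q c \<sigma>bar \<longleftrightarrow> primal_KKT p Q c xbar"
    using dual c nonneg unfolding primal_KKT_def q_def by blast
  \<comment> \<open>Complementarity turns \<open>xbar \<bullet> (Q *v xbar)\<close> into
    \<open>xbar \<bullet> c\<close>, so both objectives equal minus one half of
    \<open>xbar \<bullet> c\<close>.\<close>
  have "primal_obj Q c xbar = dual_obj p Q c \<sigma>bar" if "\<sigma>bar * q = 0"
  proof -
    have "xbar \<bullet> c = xbar \<bullet> (Q *v xbar) + \<sigma>bar * q"
      unfolding c[symmetric] G_mult_vector q_def by (simp add: inner_add_right)
    then show ?thesis
      using that by (simp add: primal_obj_def dual_obj_def assms(4)[symmetric] inner_commute)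
  qed
  with iff dual show ?thesis
    by blast
qed

end
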